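(* Let $G$ be a finite simple connected graph with $m>0$ edges, maximum degree $\Delta$ and minimum degree $\delta$. Then $$\frac{m}{\sqrt{2}} + \frac{\sqrt{2}-1}{4\sqrt{2}} \cdot \frac{\sigma(G)}{\Delta^2} \le DSO(G) \le \frac{m}{\sqrt{2}} + \frac{\sigma(G)}{8\sqrt{2}\,\delta^2}.$$ For each of the two bounds, equality holds if and only if $G$ is regular.
   Context: For a finite simple graph $G=(V(G),E(G))$, $d_u$ denotes the degree of the vertex $u$. The Diminished Sombor index is $DSO(G)=\sum_{uv\in E(G)}\frac{\sqrt{d_u^2+d_v^2}}{d_u+d_v}$. The sigma irregularity index is $\sigma(G)=\sum_{uv\in E(G)} (d_u-d_v)^2$. *)

theory Defs
  imports Complex_Main
begin

text \<open>A graph is given by its vertex set \<open>V\<close> and its set \<open>E\<close> of edges, each edge being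
  an unordered pair of distinct vertices.\<close>

definition fin_simple_graph :: "'a set \<Rightarrow> 'a set set \<Rightarrow> bool" where
  "fin_simple_graph V E \<longleftrightarrow> finite V \<and> E \<subseteq> {{u, v} | u v. u \<in> V \<and> v \<in> V \<and> u \<noteq> v}"

definition connected_graph :: "'a set \<Rightarrow> 'a set set \<Rightarrow> bool" where
  "connected_graph V E \<longleftrightarrow>
     V \<noteq> {} \<and> (\<forall>u\<in>V. \<forall>v\<in>V. (u, v) \<in> {(x, y). {x, y} \<in> E}\<^sup>*)"

definition degree :: "'a set set \<Rightarrow> 'a \<Rightarrow> nat" where
  "degree E u = card {e \<in> E. u \<in> e}"

definition max_degree :: "'a set \<Rightarrow> 'a set set \<Rightarrow> nat" where
  "max_degree V E = Max (degree E ` V)"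

definition min_degree :: "'a set \<Rightarrow> 'a set set \<Rightarrow> nat" where
  "min_degree V E = Min (degree E ` V)"

definition regular_graph :: "'a set \<Rightarrow> 'a set set \<Rightarrow> bool" where
  "regular_graph V E \<longleftrightarrow> (\<exists>k. \<forall>v\<in>V. degree E v = k)"

text \<open>The sum of \<open>f u v\<close> over the edges \<open>{u, v}\<close>, every edge being counted once. It is only
  meaningful for symmetric \<open>f\<close>, for which the value at an edge does not depend on the order
  of its endpoints (see \<open>edge_value_eq\<close>).\<close>

definition edge_value :: "('a \<Rightarrow> 'a \<Rightarrow> real) \<Rightarrow> 'a set \<Rightarrow> real" where
  "edge_value f e = (THE r. \<exists>u v. e = {u, v} \<and> r = f u v)"

definition edge_sum :: "'a set set \<Rightarrow> ('a \<Rightarrow> 'a \<Rightarrow> real) \<Rightarrow> real" where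
  "edge_sum E f = (\<Sum>e\<in>E. edge_value f e)"

lemma edge_value_eq:
  assumes "\<And>x y. f x y = f y x"
  shows "edge_value f {u, v} = f u v"
  unfolding edge_value_def
proof (rule the_equality)
  show "\<exists>a b. {u, v} = {a, b} \<and> f u v = f a b" by blast
next
  fix r assume "\<exists>a b. {u, v} = {a, b} \<and> r = f a b"
  then show "r = f u v" using assms by (auto simp: doubleton_eq_iff)
qed

definition diminished_sombor :: "'a set set \<Rightarrow> real" where
  "diminished_sombor E = edge_sum E (\<lambda>u v.
     sqrt (real (degree E u) ^ 2 + real (degree E v) ^ 2) / (real (degree E u) + real (degree E v)))"

definition sigma_irregularity :: "'a set set \<Rightarrow> real" where
  "sigma_irregularity E = edge_sum E (\<lambda>u v. (real (degree E u) - real (degree E v)) ^ 2)"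

end

theory Submission
  imports Defs
begin

text \<open>Both bounds hold edge by edge. Since
  \<open>x\<^sup>2 + y\<^sup>2 = ((x + y)\<^sup>2 + (x - y)\<^sup>2) / 2\<close>, an edge with end degrees \<open>x\<close> and \<open>y\<close>
  contributes \<open>sqrt (1 + s) / sqrt 2\<close> to the Diminished Sombor index, where
  \<open>s = (x - y)\<^sup>2 / (x + y)\<^sup>2\<close> lies in \<open>[0, 1)\<close>. The function \<open>sqrt (1 + s)\<close> is strictly concave, so
  it lies above its chord \<open>1 + (sqrt 2 - 1) s\<close> on \<open>[0, 1]\<close> and below its tangent \<open>1 + s / 2\<close>
  at \<open>0\<close>. The denominator of \<open>s\<close> lies between \<open>4 \<delta>\<^sup>2\<close> and \<open>4 \<Delta>\<^sup>2\<close>, which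
  replaces \<open>s\<close> by a multiple of \<open>(x - y)\<^sup>2\<close>; summing over the edges gives the two bounds
  (\<open>sombor_term_gt\<close>, \<open>sombor_term_lt\<close>).

  For \<open>s\<close> in \<open>[0, 1)\<close> the chord and the tangent touch the graph of the function only at \<open>s = 0\<close>, so a
  bound is attained exactly when every edge joins vertices of equal degree. In a connected
  graph this means that all degrees agree (\<open>edge_sum_bound\<close>).\<close>

section \<open>The contribution of one edge\<close>

text \<open>The chord through \<open>s = 0\<close> and \<open>s = 1\<close> has slope \<open>c = sqrt 2 - 1\<close>, the positive root of
  \<open>c\<^sup>2 + 2 c = 1\<close>; hence \<open>1 + s - (1 + c s)\<^sup>2 = c\<^sup>2 s (1 - s)\<close>.\<close>

lemma chord_less_sqrt:
  fixes s :: real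
  assumes "0 < s" "s < 1"
  shows "1 + (sqrt 2 - 1) * s < sqrt (1 + s)"
proof (rule real_less_rsqrt)
  have "(1 + s) - (1 + (sqrt 2 - 1) * s)\<^sup>2 = (sqrt 2 - 1)\<^sup>2 * (s * (1 - s))"
    by (simp add: power2_eq_square algebra_simps)
  moreover have "0 < (sqrt 2 - 1)\<^sup>2 * (s * (1 - s))"
    using assms by simp
  ultimately show "(1 + (sqrt 2 - 1) * s)\<^sup>2 < 1 + s" by linarith
qed

lemma sqrt_less_tangent:
  fixes s :: real
  assumes "0 < s"
  shows "sqrt (1 + s) < 1 + s / 2"
proof (rule real_less_lsqrt)
  show "1 + s < (1 + s / 2)\<^sup>2"
    using assms by (simp add: power2_eq_square field_simps)
qed (use assms in simp_all)

lemma sombor_term_eq: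
  fixes x y :: real
  assumes "0 < x" "0 < y"
  shows "sqrt (x\<^sup>2 + y\<^sup>2) / (x + y) = sqrt (1 + (x - y)\<^sup>2 / (x + y)\<^sup>2) / sqrt 2"
proof -
  have "(x\<^sup>2 + y\<^sup>2) / (x + y)\<^sup>2 = (1 + (x - y)\<^sup>2 / (x + y)\<^sup>2) / 2"
  proof -
    have "x\<^sup>2 + y\<^sup>2 = ((x + y)\<^sup>2 + (x - y)\<^sup>2) / 2"
      by (simp add: power2_eq_square algebra_simps)
    then show ?thesis
      using assms by (simp add: add_divide_distrib)
  qed
  then have "sqrt ((x\<^sup>2 + y\<^sup>2) / (x + y)\<^sup>2) = sqrt ((1 + (x - y)\<^sup>2 / (x + y)\<^sup>2) / 2)"
    by simp
  then show ?thesis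
    using assms by (simp add: real_sqrt_divide)
qed

lemma sombor_term_diag:
  fixes x :: real
  assumes "0 < x"
  shows "sqrt (x\<^sup>2 + x\<^sup>2) / (x + x) = 1 / sqrt 2"
  using sombor_term_eq[of x x] assms by simp

lemma sombor_term_gt:
  fixes x y b :: real
  assumes pos: "0 < x" "0 < y" and le: "x \<le> b" "y \<le> b" and "x \<noteq> y"
  shows "1 / sqrt 2 + (sqrt 2 - 1) / (4 * sqrt 2 * b\<^sup>2) * (x - y)\<^sup>2 < sqrt (x\<^sup>2 + y\<^sup>2) / (x + y)"
proof -
  define s where "s = (x - y)\<^sup>2 / (x + y)\<^sup>2"
  have "0 < s"
    using assms by (simp add: s_def)
  have "(x - y)\<^sup>2 < (x + y)\<^sup>2"
    using pos by (simp add: power2_eq_square algebra_simps)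
  then have "s < 1"
    using pos by (simp add: s_def)
  have "(x + y)\<^sup>2 \<le> (2 * b)\<^sup>2"
    using pos le by (intro power_mono) auto
  moreover have "0 < b"
    using pos le by linarith
  ultimately have "(x - y)\<^sup>2 / (4 * b\<^sup>2) \<le> s"
    unfolding s_def using pos by (intro divide_left_mono) (auto simp: power_mult_distrib)
  then have "(sqrt 2 - 1) * ((x - y)\<^sup>2 / (4 * b\<^sup>2)) \<le> (sqrt 2 - 1) * s"
    by (intro mult_left_mono) auto
  then have "1 + (sqrt 2 - 1) * ((x - y)\<^sup>2 / (4 * b\<^sup>2)) < sqrt (1 + s)"
    using chord_less_sqrt[OF \<open>0 < s\<close> \<open>s < 1\<close>] by linarith
  then have "(1 + (sqrt 2 - 1) * ((x - y)\<^sup>2 / (4 * b\<^sup>2))) / sqrt 2 < sqrt (1 + s) / sqrt 2"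
    by (intro divide_strict_right_mono) auto
  then show ?thesis
    unfolding sombor_term_eq[OF pos] s_def by (simp add: add_divide_distrib mult_ac)
qed

lemma sombor_term_lt:
  fixes x y a :: real
  assumes a: "0 < a" "a \<le> x" "a \<le> y" and "x \<noteq> y"
  shows "sqrt (x\<^sup>2 + y\<^sup>2) / (x + y) < 1 / sqrt 2 + 1 / (8 * sqrt 2 * a\<^sup>2) * (x - y)\<^sup>2"
proof -
  define s where "s = (x - y)\<^sup>2 / (x + y)\<^sup>2"
  have pos: "0 < x" "0 < y"
    using a by auto
  have "0 < s"
    using pos \<open>x \<noteq> y\<close> by (simp add: s_def)
  have "(2 * a)\<^sup>2 \<le> (x + y)\<^sup>2"
    using a by (intro power_mono) auto
  then have "s / 2 \<le> (x - y)\<^sup>2 / (4 * a\<^sup>2) / 2"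
    unfolding s_def using a pos by (intro divide_right_mono divide_left_mono) (auto simp: power_mult_distrib)
  then have "sqrt (1 + s) < 1 + (x - y)\<^sup>2 / (4 * a\<^sup>2) / 2"
    using sqrt_less_tangent[OF \<open>0 < s\<close>] by (meson add_left_mono less_le_trans)
  then have "sqrt (1 + s) / sqrt 2 < (1 + (x - y)\<^sup>2 / (4 * a\<^sup>2) / 2) / sqrt 2"
    by (intro divide_strict_right_mono) auto
  then show ?thesis
    unfolding sombor_term_eq[OF pos] s_def by (simp add: add_divide_distrib mult_ac)
qed

section \<open>Degrees in a connected graph\<close>

lemma finite_edges:
  assumes "fin_simple_graph V E"
  shows "finite E"
proof (rule finite_subset)
  show "E \<subseteq> Pow V" "finite (Pow V)"
    using assms by (auto simp: fin_simple_graph_def)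
qed

lemma edge_endpoints:
  assumes "fin_simple_graph V E" "{u, v} \<in> E"
  shows "u \<in> V" "v \<in> V"
  using assms by (auto simp: fin_simple_graph_def doubleton_eq_iff)

lemma edge_cases:
  assumes "fin_simple_graph V E" "e \<in> E"
  obtains u v where "e = {u, v}" "u \<in> V" "v \<in> V" "u \<noteq> v"
  using assms unfolding fin_simple_graph_def by blast

text \<open>An edge provides two vertices, so every vertex has some other vertex to be joined to, and
  the walk there leaves it along an edge.\<close>

lemma degree_pos:
  assumes G: "fin_simple_graph V E" and conn: "connected_graph V E" and "E \<noteq> {}" and "u \<in> V"
  shows "0 < degree E u"
proof -
  obtain e where "e \<in> E"
    using \<open>E \<noteq> {}\<close> by blast
  then obtain a b where "a \<in> V" "b \<in> V" "a \<noteq> b"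
    using edge_cases[OF G] by blast
  then obtain w where "w \<in> V" "w \<noteq> u"
    by metis
  then have "(u, w) \<in> {(x, y). {x, y} \<in> E}\<^sup>*"
    using conn \<open>u \<in> V\<close> by (auto simp: connected_graph_def)
  then obtain z where "{u, z} \<in> E"
    using \<open>w \<noteq> u\<close> by (auto elim: converse_rtranclE)
  then show ?thesis
    using finite_edges[OF G] by (auto simp: degree_def card_gt_0_iff)
qed

lemma degree_bounds:
  assumes "fin_simple_graph V E" "v \<in> V"
  shows "degree E v \<le> max_degree V E" "min_degree V E \<le> degree E v"
  using assms by (auto simp: fin_simple_graph_def max_degree_def min_degree_def)

lemma min_degree_pos:
  assumes "fin_simple_graph V E" "connected_graph V E" "E \<noteq> {}"
  shows "0 < min_degree V E"
proof -
  have "finite V" "V \<noteq> {}"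
    using assms by (auto simp: fin_simple_graph_def connected_graph_def)
  then show ?thesis
    using degree_pos[OF assms] by (simp add: min_degree_def)
qed

lemma regular_graph_iff_edges:
  assumes G: "fin_simple_graph V E" and conn: "connected_graph V E"
  shows "regular_graph V E \<longleftrightarrow> (\<forall>u v. {u, v} \<in> E \<longrightarrow> degree E u = degree E v)"
proof
  assume "regular_graph V E"
  then show "\<forall>u v. {u, v} \<in> E \<longrightarrow> degree E u = degree E v"
    using edge_endpoints[OF G] by (metis regular_graph_def)
next
  assume edges: "\<forall>u v. {u, v} \<in> E \<longrightarrow> degree E u = degree E v"
  have walk: "degree E u = degree E v" if "(u, v) \<in> {(x, y). {x, y} \<in> E}\<^sup>*" for u v
    using that by (induction rule: rtrancl_induct) (use edges in auto)
  obtain r where "r \<in> V"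
    using conn by (auto simp: connected_graph_def)
  then have "\<forall>v\<in>V. degree E v = degree E r"
    using conn walk by (metis connected_graph_def)
  then show "regular_graph V E"
    unfolding regular_graph_def by blast
qed

section \<open>Summation over the edges\<close>

lemma edge_sum_affine:
  assumes G: "fin_simple_graph V E" and sym: "\<And>x y. f x y = f y x"
  shows "edge_sum E (\<lambda>u v. a + c * f u v) = real (card E) * a + c * edge_sum E f"
proof -
  have "edge_value (\<lambda>u v. a + c * f u v) e = a + c * edge_value f e" if "e \<in> E" for e
  proof -
    obtain u v where "e = {u, v}"
      using edge_cases[OF G \<open>e \<in> E\<close>] by blast
    moreover have "edge_value (\<lambda>u v. a + c * f u v) {u, v} = a + c * f u v"
      by (rule edge_value_eq) (simp add: sym)
    ultimately show ?thesis
      using edge_value_eq[of f, OF sym] by simp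
  qed
  then show ?thesis
    by (simp add: edge_sum_def sum.distrib sum_distrib_left)
qed

text \<open>The common form of both bounds: an edgewise inequality that is strict exactly at the edges
  whose end degrees differ. Equality of the sums then forces equality at every edge.\<close>

lemma edge_sum_bound:
  assumes G: "fin_simple_graph V E" and conn: "connected_graph V E"
    and f: "\<And>x y. f x y = f y x" and g: "\<And>x y. g x y = g y x"
    and eq: "\<And>u v. {u, v} \<in> E \<Longrightarrow> degree E u = degree E v \<Longrightarrow> f u v = g u v"
    and less: "\<And>u v. {u, v} \<in> E \<Longrightarrow> degree E u \<noteq> degree E v \<Longrightarrow> f u v < g u v"
  shows "edge_sum E f \<le> edge_sum E g"
    and "edge_sum E f = edge_sum E g \<longleftrightarrow> regular_graph V E"
proof -
  have val: "edge_value f {u, v} = f u v" "edge_value g {u, v} = g u v" for u v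
    by (rule edge_value_eq, rule f, rule edge_value_eq, rule g)
  have le: "edge_value f e \<le> edge_value g e" if "e \<in> E" for e
  proof -
    obtain u v where "e = {u, v}"
      using edge_cases[OF G \<open>e \<in> E\<close>] by blast
    with that show ?thesis
      using eq[of u v] less[of u v] by (cases "degree E u = degree E v") (auto simp: val)
  qed
  then show "edge_sum E f \<le> edge_sum E g"
    by (simp add: edge_sum_def sum_mono)
  have "edge_sum E f = edge_sum E g \<longleftrightarrow> (\<forall>e\<in>E. edge_value f e = edge_value g e)"
    unfolding edge_sum_def using sum_mono_inv[OF _ le] finite_edges[OF G]
    by (auto intro: sum.cong)
  also have "\<dots> \<longleftrightarrow> (\<forall>u v. {u, v} \<in> E \<longrightarrow> f u v = g u v)"
    using G by (auto simp flip: val elim: edge_cases)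
  also have "\<dots> \<longleftrightarrow> (\<forall>u v. {u, v} \<in> E \<longrightarrow> degree E u = degree E v)"
    using eq less by (metis less_irrefl)
  finally show "edge_sum E f = edge_sum E g \<longleftrightarrow> regular_graph V E"
    by (simp add: regular_graph_iff_edges[OF G conn])
qed

section \<open>Bounds for the Diminished Sombor index\<close>

theorem theorem12:
  fixes V :: "'a set" and E :: "'a set set" and m \<Delta> \<delta> :: nat
  assumes "fin_simple_graph V E"
    and "connected_graph V E"
    and "m = card E" and "m > 0"
    and "\<Delta> = max_degree V E" and "\<delta> = min_degree V E"
  shows "real m / sqrt 2 + (sqrt 2 - 1) / (4 * sqrt 2) * (sigma_irregularity E / real \<Delta> ^ 2)
           \<le> diminished_sombor E
       \<and> diminished_sombor E
           \<le> real m / sqrt 2 + sigma_irregularity E / (8 * sqrt 2 * real \<delta> ^ 2)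
       \<and> (real m / sqrt 2 + (sqrt 2 - 1) / (4 * sqrt 2) * (sigma_irregularity E / real \<Delta> ^ 2)
             = diminished_sombor E \<longleftrightarrow> regular_graph V E)
       \<and> (diminished_sombor E
             = real m / sqrt 2 + sigma_irregularity E / (8 * sqrt 2 * real \<delta> ^ 2)
           \<longleftrightarrow> regular_graph V E)"
proof -
  note G = assms(1) and conn = assms(2)
  have "E \<noteq> {}"
    using assms(3,4) by auto
  define d where "d = (\<lambda>u. real (degree E u))"
  define D where "D = (\<lambda>u v. sqrt ((d u)\<^sup>2 + (d v)\<^sup>2) / (d u + d v))"
  define B where "B = (\<lambda>c u v. 1 / sqrt 2 + c * (d u - d v)\<^sup>2)"
  define lo where "lo = (sqrt 2 - 1) / (4 * sqrt 2 * (real \<Delta>)\<^sup>2)"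
  define hi where "hi = 1 / (8 * sqrt 2 * (real \<delta>)\<^sup>2)"

  have DSO: "diminished_sombor E = edge_sum E D"
    by (simp add: diminished_sombor_def D_def d_def)
  have sumB: "edge_sum E (B c) = real m / sqrt 2 + c * sigma_irregularity E" for c
    unfolding B_def sigma_irregularity_def assms(3) d_def
    by (subst edge_sum_affine[OF G]) (simp_all add: power2_commute)
  have lower: "real m / sqrt 2 + (sqrt 2 - 1) / (4 * sqrt 2) * (sigma_irregularity E / real \<Delta> ^ 2)
      = edge_sum E (B lo)"
    by (simp add: sumB lo_def)
  have upper: "real m / sqrt 2 + sigma_irregularity E / (8 * sqrt 2 * real \<delta> ^ 2)
      = edge_sum E (B hi)"
    by (simp add: sumB hi_def)

  have symD: "D u v = D v u" and symB: "B c u v = B c v u" for c u v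
    by (simp_all add: D_def B_def add.commute power2_commute)
  have "0 < \<delta>"
    using min_degree_pos[OF G conn \<open>E \<noteq> {}\<close>] assms(6) by simp
  have deg: "0 < d u" "d u \<le> real \<Delta>" "real \<delta> \<le> d u" if "u \<in> V" for u
    using degree_pos[OF G conn \<open>E \<noteq> {}\<close> that] degree_bounds[OF G that] assms(5,6)
    by (simp_all add: d_def)
  have eq: "B c u v = D u v" if "{u, v} \<in> E" "degree E u = degree E v" for c u v
    using sombor_term_diag[of "d u"] deg edge_endpoints[OF G that(1)] that(2)
    by (simp add: B_def D_def d_def)
  have lo_less: "B lo u v < D u v" if "{u, v} \<in> E" "degree E u \<noteq> degree E v" for u v
    unfolding B_def D_def lo_def
    using sombor_term_gt deg edge_endpoints[OF G that(1)] that(2) by (simp add: d_def)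
  have hi_less: "D u v < B hi u v" if "{u, v} \<in> E" "degree E u \<noteq> degree E v" for u v
    unfolding B_def D_def hi_def
    using deg edge_endpoints[OF G that(1)] that(2) \<open>0 < \<delta>\<close>
    by (intro sombor_term_lt) (simp_all add: d_def)

  show ?thesis
    unfolding DSO lower upper
    using edge_sum_bound[OF G conn symB symD eq lo_less]
      edge_sum_bound[OF G conn symD symB eq[symmetric] hi_less]
    by simp
qed

end
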